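(* Let $L$ be a bounded chain and let $n\geqslant 1$. A nondecreasing function $f\colon L^{n}\rightarrow L$ is a polynomial function if and only if it is weakly median decomposable.
   Context: A bounded chain is a totally ordered set $L$ with least element $0$ and greatest element $1$, viewed as a lattice with $\wedge=\min$, $\vee=\max$. $L^n$ has the componentwise order and operations. A polynomial function $L^n\to L$ is any function obtained by finitely many applications of: (i) for each $i\in\{1,\ldots,n\}$ and $c\in L$, the projection $\mathbf{x}\mapsto x_i$ and the constant function $\mathbf{x}\mapsto c$ are polynomial functions; (ii) if $f,g$ are polynomial functions then so are $f\vee g$ and $f\wedge g$ (pointwise). $f$ is nondecreasing if $\mathbf{a}\leqslant\mathbf{b}$ implies $f(\mathbf{a})\leqslant f(\mathbf{b})$. $\operatorname{med}(x,y,z)=(x\wedge y)\vee(y\wedge z)\vee(z\wedge x)$. For $\mathbf{x}\in L^n$, $k\in\{1,\ldots,n\}$, $c\in L$, let $\mathbf{x}_k^c=(x_1,\ldots,x_{k-1},c,x_{k+1},\ldots,x_n)$. For integers $p,q$, let $L_n^{(p,q)}=\{\mathbf{x}\in L^n: |\{x_1,\ldots,x_n\}\cap\{0,1\}|\geqslant p \text{ and } |\{x_1,\ldots,x_n\}|\leqslant q\}$. A function $f\colon L^n\to L$ is weakly median decomposable if $f(\mathbf{x})=\operatorname{med}\big(f(\mathbf{x}_k^0),x_k,f(\mathbf{x}_k^1)\big)$ for every $\mathbf{x}\in L_n^{(0,2)}\cup L_n^{(1,3)}$ and every $k\in\{1,\ldots,n\}$. *)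

theory Defs
  imports Main
begin

text \<open>A bounded chain is a type of sort \<open>{linorder, bounded_lattice}\<close>: the class axioms force
  \<open>inf\<close> and \<open>sup\<close> to be \<open>min\<close> and \<open>max\<close>, and \<open>bot\<close>, \<open>top\<close> are the endpoints 0 and 1.
  The power \<open>L^n\<close> is the function type \<open>'n \<Rightarrow> 'a\<close> over a finite index type, with
  \<open>n = CARD('n) \<ge> 1\<close>, ordered componentwise.\<close>

inductive polynomial_function :: "(('n \<Rightarrow> 'a::bounded_lattice) \<Rightarrow> 'a) \<Rightarrow> bool" where
  proj: "polynomial_function (\<lambda>x. x i)"
| const: "polynomial_function (\<lambda>x. c)"
| sup: "polynomial_function f \<Longrightarrow> polynomial_function g \<Longrightarrow> polynomial_function (\<lambda>x. sup (f x) (g x))"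
| inf: "polynomial_function f \<Longrightarrow> polynomial_function g \<Longrightarrow> polynomial_function (\<lambda>x. inf (f x) (g x))"

definition med :: "'a::lattice \<Rightarrow> 'a \<Rightarrow> 'a \<Rightarrow> 'a" where
  "med x y z = sup (sup (inf x y) (inf y z)) (inf z x)"

definition restricted_tuples :: "int \<Rightarrow> int \<Rightarrow> ('n::finite \<Rightarrow> 'a::bounded_lattice) set" where
  "restricted_tuples p q =
     {x. p \<le> int (card (range x \<inter> {bot, top})) \<and> int (card (range x)) \<le> q}"

definition weakly_median_decomposable ::
    "(('n::finite \<Rightarrow> 'a::bounded_lattice) \<Rightarrow> 'a) \<Rightarrow> bool" where
  "weakly_median_decomposable f \<longleftrightarrow>
     (\<forall>x \<in> restricted_tuples 0 2 \<union> restricted_tuples 1 3. \<forall>k.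
        f x = med (f (x(k := bot))) (x k) (f (x(k := top))))"

end

theory Submission
  imports Defs
begin

text \<open>
  For a monotone function, the decomposition at coordinate \<open>k\<close> says that \<open>f x\<close> is \<open>x k\<close> clamped
  to the interval from \<open>f (x(k := bot))\<close> to \<open>f (x(k := top))\<close>. On a chain, clamping commutes with
  \<open>sup\<close> and \<open>inf\<close>, so induction shows that every polynomial function is decomposable, even at every
  point (\<open>polynomial_function_imp_med\<close>).

  Conversely, write \<open>1\<^sub>S\<close> for the vertex of the cube that is \<open>top\<close> on \<open>S\<close> and \<open>bot\<close> off \<open>S\<close>. A weakly
  median decomposable monotone \<open>f\<close> should equal its disjunctive normal form, the supremum over all
  \<open>S\<close> of \<open>inf (f 1\<^sub>S) (\<Sqinter>i\<in>S. x i)\<close>, which is a polynomial function. The link between \<open>f x\<close> and \<open>f 1\<^sub>S\<close>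
  is a walk through points with values in \<open>{bot, c, top}\<close> only. Each such point is the constant \<open>c\<close> or
  has a value in \<open>{bot, top}\<close>, hence lies in the domain where the decomposition is assumed. Replacing
  the value \<open>c\<close> by \<open>top\<close> or \<open>bot\<close>, one coordinate at a time, and squeezing by monotonicity gives
  \<^item> \<open>inf c (f 1\<^sub>S) \<le> f x\<close> if \<open>c \<le> x i\<close> on \<open>S\<close> (\<open>inf_vertex_le\<close>),
  \<^item> \<open>f x \<le> sup d (f 1\<^sub>S)\<close> if \<open>x i \<le> d\<close> off \<open>S\<close> (\<open>le_sup_vertex\<close>).

  The first bound says that the normal form lies below \<open>f\<close>. If its value \<open>a\<close> at \<open>x\<close> were strictly below
  \<open>f x\<close>, take \<open>S = {i. a < x i}\<close>: the second bound with \<open>d = a\<close> gives \<open>a < f 1\<^sub>S\<close>, so, the order being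
  total, the term of \<open>S\<close> in the normal form exceeds \<open>a\<close>, a contradiction.
\<close>


section \<open>Polynomial functions are median decomposable\<close>

lemma le_sup_iff_disj:
  fixes x y z :: "'a::{linorder, semilattice_sup}"
  shows "z \<le> sup x y \<longleftrightarrow> z \<le> x \<or> z \<le> y"
  by (simp add: sup_max le_max_iff_disj)

text \<open>Equalities between lattice terms over a chain reduce, through the lower bounds of both sides,
  to propositional logic; this is the form in which the clamping operation is used.\<close>

lemma le_med_iff:
  fixes a b y z :: "'a::{linorder, lattice}"
  assumes "a \<le> b"
  shows "z \<le> med a y b \<longleftrightarrow> z \<le> a \<or> z \<le> y \<and> z \<le> b"
  using assms by (auto simp: med_def le_sup_iff_disj)

lemma sup_med:
  fixes a b y :: "'a::{linorder, lattice}"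
  assumes "a \<le> b" "a' \<le> b'"
  shows "sup (med a y b) (med a' y b') = med (sup a a') y (sup b b')"
proof -
  have "sup a a' \<le> sup b b'"
    using assms by (rule sup_mono)
  then have "z \<le> sup (med a y b) (med a' y b') \<longleftrightarrow> z \<le> med (sup a a') y (sup b b')" for z
    using assms by (auto simp: le_med_iff le_sup_iff_disj)
  then show ?thesis
    by (meson order.antisym order.refl)
qed

lemma inf_med:
  fixes a b y :: "'a::{linorder, lattice}"
  assumes "a \<le> b" "a' \<le> b'"
  shows "inf (med a y b) (med a' y b') = med (inf a a') y (inf b b')"
proof -
  have "inf a a' \<le> inf b b'"
    using assms by (rule inf_mono)
  then have "z \<le> inf (med a y b) (med a' y b') \<longleftrightarrow> z \<le> med (inf a a') y (inf b b')" for z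
    using assms by (auto simp: le_med_iff)
  then show ?thesis
    by (meson order.antisym order.refl)
qed

lemma med_same: "med a y a = a"
  by (simp add: med_def sup.absorb2 le_infI1 le_infI2)

lemma mono_polynomial_function:
  assumes "polynomial_function f"
  shows "mono f"
  using assms
proof induction
  case (proj i)
  show ?case by (rule monoI) (simp add: le_funD)
next
  case (const c)
  show ?case by (auto intro: monoI)
next
  case (sup f g)
  then show ?case by (auto intro!: monoI sup_mono dest: monoD)
next
  case (inf f g)
  then show ?case by (auto intro!: monoI inf_mono dest: monoD)
qed

lemma mono_fun_upd_bot_le_top:
  fixes f :: "('n \<Rightarrow> 'a::bounded_lattice) \<Rightarrow> 'b::order"
  assumes "mono f"
  shows "f (x(k := bot)) \<le> f (x(k := top))"
  using assms by (rule monoD) (simp add: le_fun_def)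

lemma polynomial_function_imp_med:
  fixes f :: "('n \<Rightarrow> 'a::{linorder, bounded_lattice}) \<Rightarrow> 'a"
  assumes "polynomial_function f"
  shows "f x = med (f (x(k := bot))) (x k) (f (x(k := top)))"
  using assms
proof induction
  case (proj i)
  show ?case by (cases "i = k") (simp_all add: med_same, simp add: med_def)
next
  case (const c)
  show ?case by (simp add: med_same)
next
  case (sup f g)
  then show ?case
    by (metis sup_med mono_polynomial_function mono_fun_upd_bot_le_top)
next
  case (inf f g)
  then show ?case
    by (metis inf_med mono_polynomial_function mono_fun_upd_bot_le_top)
qed


section \<open>Comparing values of a decomposable function with those at vertices\<close>

lemma three_valued_mem_restricted_tuples:
  fixes x :: "'n::finite \<Rightarrow> 'a::bounded_lattice"
  assumes "range x \<subseteq> {bot, c, top}"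
  shows "x \<in> restricted_tuples 0 2 \<union> restricted_tuples 1 3"
proof (cases "range x \<inter> {bot, top} = {}")
  case True
  with assms have "range x \<subseteq> {c}"
    by blast
  then have "card (range x) \<le> 1"
    using card_mono[of "{c}" "range x"] by simp
  then show ?thesis
    by (simp add: restricted_tuples_def)
next
  case False
  then have "card (range x \<inter> {bot, top}) \<ge> 1"
    by (simp add: Suc_le_eq card_gt_0_iff)
  moreover have "card (range x) \<le> card {bot, c, top}"
    using assms by (intro card_mono) auto
  moreover have "card {bot, c, top} \<le> 3"
    by (simp add: card_insert_if)
  ultimately show ?thesis
    by (simp add: restricted_tuples_def)
qed

lemma three_valued_med:
  assumes "weakly_median_decomposable f" "range x \<subseteq> {bot, c, top}"
  shows "f x = med (f (x(k := bot))) (x k) (f (x(k := top)))"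
  using assms three_valued_mem_restricted_tuples
  unfolding weakly_median_decomposable_def by blast

text \<open>A coordinate with value \<open>c\<close> may be raised to \<open>top\<close> at the price of a meet with \<open>c\<close>, because
  \<open>inf c (f (x(k := top)))\<close> is one of the three joinands of the median. Meets with the same \<open>c\<close> do not
  accumulate, so this works for any set \<open>A\<close> of coordinates.\<close>

lemma inf_override_top_le:
  fixes f :: "('n::finite \<Rightarrow> 'a::bounded_lattice) \<Rightarrow> 'a"
  assumes f: "weakly_median_decomposable f"
    and x: "range x \<subseteq> {bot, c, top}" and A: "\<And>k. k \<in> A \<Longrightarrow> x k = c"
  shows "inf c (f (override_on x (\<lambda>_. top) A)) \<le> f x"
proof -
  have "finite A" by simp
  then show ?thesis
    using A
  proof induction
    case empty
    show ?case by simp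
  next
    case (insert k A)
    let ?y = "override_on x (\<lambda>_. top) A"
    have "range ?y \<subseteq> {bot, c, top}"
      using x by (auto simp: override_on_def)
    with f have "f ?y = med (f (?y(k := bot))) (?y k) (f (?y(k := top)))"
      by (rule three_valued_med)
    also have "?y k = c"
      using insert by simp
    finally have "inf c (f (?y(k := top))) \<le> f ?y"
      by (simp only: med_def le_supI1 sup_ge2)
    then have "inf c (f (?y(k := top))) \<le> inf c (f ?y)"
      by simp
    also have "\<dots> \<le> f x"
      using insert by simp
    finally show ?case
      by (simp only: override_on_insert)
  qed
qed

lemma le_sup_override_bot:
  fixes f :: "('n::finite \<Rightarrow> 'a::bounded_lattice) \<Rightarrow> 'a"
  assumes f: "weakly_median_decomposable f"
    and x: "range x \<subseteq> {bot, c, top}" and A: "\<And>k. k \<in> A \<Longrightarrow> x k = c"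
  shows "f x \<le> sup c (f (override_on x (\<lambda>_. bot) A))"
proof -
  have "finite A" by simp
  then show ?thesis
    using A
  proof induction
    case empty
    show ?case by simp
  next
    case (insert k A)
    let ?y = "override_on x (\<lambda>_. bot) A"
    have "range ?y \<subseteq> {bot, c, top}"
      using x by (auto simp: override_on_def)
    with f have "f ?y = med (f (?y(k := bot))) (?y k) (f (?y(k := top)))"
      by (rule three_valued_med)
    also have "?y k = c"
      using insert by simp
    finally have "f ?y \<le> sup c (f (?y(k := bot)))"
      by (simp only: med_def le_sup_iff le_supI1 le_supI2 le_infI1 le_infI2 order.refl)
    then have "sup c (f ?y) \<le> sup c (f (?y(k := bot)))"
      by simp
    with insert have "f x \<le> sup c (f (?y(k := bot)))"
      by (auto intro: order.trans)
    then show ?case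
      by (simp only: override_on_insert)
  qed
qed

definition vertex :: "'n set \<Rightarrow> 'n \<Rightarrow> 'a::bounded_lattice" where
  "vertex S = (\<lambda>i. if i \<in> S then top else bot)"

lemma inf_vertex_le:
  fixes f :: "('n::finite \<Rightarrow> 'a::bounded_lattice) \<Rightarrow> 'a"
  assumes "mono f" "weakly_median_decomposable f" "\<And>i. i \<in> S \<Longrightarrow> c \<le> x i"
  shows "inf c (f (vertex S)) \<le> f x"
proof -
  \<comment> \<open>The least point that is at least \<open>c\<close> on \<open>S\<close>: it lies below \<open>x\<close>, and raising its value \<open>c\<close>
    to \<open>top\<close> turns it into the vertex.\<close>
  let ?y = "\<lambda>i. if i \<in> S then c else bot"
  have "vertex S = override_on ?y (\<lambda>_. top) S"
    by (auto simp: vertex_def override_on_def)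
  moreover have "inf c (f (override_on ?y (\<lambda>_. top) S)) \<le> f ?y"
    using assms(2) by (rule inf_override_top_le) auto
  moreover have "f ?y \<le> f x"
    using assms by (intro monoD[OF \<open>mono f\<close>]) (auto simp: le_fun_def)
  ultimately show ?thesis
    by simp
qed

lemma le_sup_vertex:
  fixes f :: "('n::finite \<Rightarrow> 'a::bounded_lattice) \<Rightarrow> 'a"
  assumes "mono f" "weakly_median_decomposable f" "\<And>i. i \<notin> S \<Longrightarrow> x i \<le> d"
  shows "f x \<le> sup d (f (vertex S))"
proof -
  let ?y = "\<lambda>i. if i \<in> S then top else d"
  have "vertex S = override_on ?y (\<lambda>_. bot) (- S)"
    by (auto simp: vertex_def override_on_def)
  moreover have "f ?y \<le> sup d (f (override_on ?y (\<lambda>_. bot) (- S)))"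
    using assms(2) by (rule le_sup_override_bot) auto
  moreover have "f x \<le> f ?y"
    using assms by (intro monoD[OF \<open>mono f\<close>]) (auto simp: le_fun_def)
  ultimately show ?thesis
    by simp
qed


section \<open>The disjunctive normal form\<close>

text \<open>Inserting \<open>top\<close> into the meet only serves to make the term of \<open>S = {}\<close> equal to \<open>f 1\<^sub>S\<close>.\<close>

definition vertex_dnf :: "(('n \<Rightarrow> 'a::bounded_lattice) \<Rightarrow> 'a) \<Rightarrow> ('n \<Rightarrow> 'a) \<Rightarrow> 'a" where
  "vertex_dnf f x =
     \<Squnion>\<^sub>f\<^sub>i\<^sub>n (range (\<lambda>S. inf (f (vertex S)) (\<Sqinter>\<^sub>f\<^sub>i\<^sub>n (insert top (x ` S)))))"

lemma polynomial_function_Sup_fin: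
  assumes "finite I" "I \<noteq> {}" "\<And>i. i \<in> I \<Longrightarrow> polynomial_function (g i)"
  shows "polynomial_function (\<lambda>x. \<Squnion>\<^sub>f\<^sub>i\<^sub>n ((\<lambda>i. g i x) ` I))"
  using assms by (induction rule: finite_ne_induct) (simp_all add: polynomial_function.sup)

lemma polynomial_function_Inf_fin_coordinates:
  assumes "finite S"
  shows "polynomial_function (\<lambda>x. \<Sqinter>\<^sub>f\<^sub>i\<^sub>n (insert top (x ` S)))"
  using assms
proof induction
  case empty
  show ?case by (simp add: polynomial_function.const)
next
  case (insert i S)
  then have "\<Sqinter>\<^sub>f\<^sub>i\<^sub>n (insert top (x ` insert i S)) = inf (x i) (\<Sqinter>\<^sub>f\<^sub>i\<^sub>n (insert top (x ` S)))"
    for x :: "'a \<Rightarrow> 'b"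
    by (simp add: insert_commute[of top])
  with insert.IH show ?case
    by (simp only:) (intro polynomial_function.inf polynomial_function.proj)
qed

lemma polynomial_function_vertex_dnf:
  fixes f :: "('n::finite \<Rightarrow> 'a::bounded_lattice) \<Rightarrow> 'a"
  shows "polynomial_function (vertex_dnf f)"
  unfolding vertex_dnf_def
  by (intro polynomial_function_Sup_fin polynomial_function.inf polynomial_function.const
      polynomial_function_Inf_fin_coordinates) simp_all

lemma vertex_dnf_eq:
  fixes f :: "('n::finite \<Rightarrow> 'a::{linorder, bounded_lattice}) \<Rightarrow> 'a"
  assumes "mono f" "weakly_median_decomposable f"
  shows "vertex_dnf f x = f x"
proof (rule order.antisym)
  show "vertex_dnf f x \<le> f x"
    unfolding vertex_dnf_def
  proof (rule Sup_fin.boundedI)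
    fix t
    assume "t \<in> range (\<lambda>S. inf (f (vertex S)) (\<Sqinter>\<^sub>f\<^sub>i\<^sub>n (insert top (x ` S))))"
    then obtain S where t: "t = inf (f (vertex S)) (\<Sqinter>\<^sub>f\<^sub>i\<^sub>n (insert top (x ` S)))"
      by auto
    have "\<Sqinter>\<^sub>f\<^sub>i\<^sub>n (insert top (x ` S)) \<le> x i" if "i \<in> S" for i
      using that by (intro Inf_fin.coboundedI) auto
    with assms show "t \<le> f x"
      unfolding t by (subst inf_commute) (rule inf_vertex_le)
  qed auto
next
  show "f x \<le> vertex_dnf f x"
  proof (rule ccontr)
    assume "\<not> f x \<le> vertex_dnf f x"
    then have less: "vertex_dnf f x < f x"
      by simp
    define S where "S = {i. vertex_dnf f x < x i}"
    have "f x \<le> sup (vertex_dnf f x) (f (vertex S))"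
      using assms by (rule le_sup_vertex) (simp add: S_def)
    with less have "vertex_dnf f x < f (vertex S)"
      by (auto simp: le_sup_iff_disj)
    moreover have "vertex_dnf f x < \<Sqinter>\<^sub>f\<^sub>i\<^sub>n (insert top (x ` S))"
      using less order.strict_trans2[OF less top_greatest]
      by (auto simp: S_def Inf_fin_Min)
    moreover have "inf (f (vertex S)) (\<Sqinter>\<^sub>f\<^sub>i\<^sub>n (insert top (x ` S))) \<le> vertex_dnf f x"
      unfolding vertex_dnf_def by (rule Sup_fin.coboundedI) auto
    ultimately show False
      by (auto simp: inf_min min_le_iff_disj)
  qed
qed


section \<open>The characterization\<close>

theorem theorem17:
  fixes f :: "('n::finite \<Rightarrow> 'a::{linorder, bounded_lattice}) \<Rightarrow> 'a"
  assumes "mono f"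
  shows "polynomial_function f \<longleftrightarrow> weakly_median_decomposable f"
proof
  assume "polynomial_function f"
  then show "weakly_median_decomposable f"
    unfolding weakly_median_decomposable_def by (blast intro: polynomial_function_imp_med)
next
  assume "weakly_median_decomposable f"
  with assms have "vertex_dnf f = f"
    by (intro ext vertex_dnf_eq)
  then show "polynomial_function f"
    using polynomial_function_vertex_dnf[of f] by simp
qed

end
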